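(* Let $p_1,\dots,p_m,q_1,\dots,q_k\in\mathbf{C}[x_1,\dots,x_n]$. If the algebraic varieties $V(p_1,\dots,p_m)$ and $V(q_1,\dots,q_k)$ in $\mathbf{C}^n$ are isomorphic, then the varieties $V(p_1,\dots,p_m,x_{n+1},\dots,x_{2n})$ and $V(q_1,\dots,q_k,x_{n+1},\dots,x_{2n})$ in $\mathbf{C}^{2n}$ are equivalent under a tame automorphism of $\mathbf{C}^{2n}$.
   Context: $V(p_1,\dots,p_m)$ denotes the algebraic variety $\{p_i=0,\ i=1,\dots,m\}$ in affine space, considered as an affine scheme (i.e. together with the ideal $\langle p_1,\dots,p_m\rangle$, not its radical). Two varieties $V(p_1,\dots,p_m)$ and $V(q_1,\dots,q_k)$ in $\mathbf{C}^n$ are isomorphic if the $\mathbf{C}$-algebras $\mathbf{C}[x_1,\dots,x_n]/\langle p_1,\dots,p_m\rangle$ and $\mathbf{C}[x_1,\dots,x_n]/\langle q_1,\dots,q_k\rangle$ are isomorphic. Two varieties in $\mathbf{C}^N$ are equivalent under a (polynomial) automorphism of $\mathbf{C}^N$ if this automorphism takes one of them onto the other; in terms of ideals, the corresponding $\mathbf{C}$-algebra automorphism of $\mathbf{C}[x_1,\dots,x_N]$ maps the ideal of one variety onto the ideal of the other. An automorphism is tame if it is a product (composition) of elementary and linear automorphisms, where elementary automorphisms are those that change only one variable. *)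

theory Defs
  imports Complex_Main "HOL-Library.Poly_Mapping" "HOL-Algebra.QuotRing"
begin

text \<open>
  Polynomials over the complex numbers in the variables \<open>X 1, X 2, \<dots>\<close>: finitely supported
  maps from monomials (finitely supported exponent vectors) to coefficients.  The type carries
  the monoid algebra structure of \<^theory>\<open>HOL-Library.Poly_Mapping\<close>.
\<close>

type_synonym cpoly = "(nat \<Rightarrow>\<^sub>0 nat) \<Rightarrow>\<^sub>0 complex"

definition Const :: "complex \<Rightarrow> cpoly"
  where "Const c = Poly_Mapping.single 0 c"

definition X :: "nat \<Rightarrow> cpoly"
  where "X i = Poly_Mapping.single (Poly_Mapping.single i 1) 1"

definition vars :: "cpoly \<Rightarrow> nat set"
  where "vars p = (\<Union>m\<in>Poly_Mapping.keys p. Poly_Mapping.keys m)"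

definition poly_ring :: "nat \<Rightarrow> cpoly ring"
  where "poly_ring n =
    \<lparr>carrier = {p. vars p \<subseteq> {1..n}}, mult = (*), one = 1, zero = 0, add = (+)\<rparr>"

text \<open>
  Varieties are taken as affine schemes, so a variety in affine \<open>n\<close>-space is represented by the
  ideal generated by its defining polynomials, not by its radical or its zero set.
\<close>

definition V :: "nat \<Rightarrow> cpoly list \<Rightarrow> cpoly set"
  where "V n ps = genideal (poly_ring n) (set ps)"

definition coordinate_ring :: "nat \<Rightarrow> cpoly set \<Rightarrow> cpoly set ring"
  where "coordinate_ring n I = poly_ring n Quot I"

definition coordinate_const :: "nat \<Rightarrow> cpoly set \<Rightarrow> complex \<Rightarrow> cpoly set"
  where "coordinate_const n I c = I +>\<^bsub>poly_ring n\<^esub> Const c"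

text \<open>
  A commutative algebra over the complex numbers is a ring \<open>R\<close> together with its structure map
  \<open>\<eta>\<close> from the complex numbers to \<open>R\<close>; an algebra homomorphism is a ring homomorphism that
  commutes with the structure maps.
\<close>

definition alg_iso ::
  "('a, 'm) ring_scheme \<Rightarrow> (complex \<Rightarrow> 'a) \<Rightarrow> ('b, 'n) ring_scheme \<Rightarrow> (complex \<Rightarrow> 'b) \<Rightarrow> ('a \<Rightarrow> 'b) set"
  where "alg_iso R \<eta> S \<theta> = {h \<in> ring_iso R S. \<forall>c. h (\<eta> c) = \<theta> c}"

definition isomorphic_varieties :: "nat \<Rightarrow> cpoly set \<Rightarrow> cpoly set \<Rightarrow> bool"
  where "isomorphic_varieties n I J \<longleftrightarrow>
    alg_iso (coordinate_ring n I) (coordinate_const n I)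
            (coordinate_ring n J) (coordinate_const n J) \<noteq> {}"

text \<open>
  A polynomial automorphism \<open>(F\<^sub>1, \<dots>, F\<^sub>N)\<close> of affine \<open>N\<close>-space is represented by the algebra
  automorphism of the polynomial ring sending \<open>X i\<close> to \<open>F\<^sub>i\<close>.  Only the values on the
  carrier matter; nothing is required of such a map outside it.
\<close>

definition poly_aut :: "nat \<Rightarrow> (cpoly \<Rightarrow> cpoly) set"
  where "poly_aut N = alg_iso (poly_ring N) Const (poly_ring N) Const"

definition elementary_aut :: "nat \<Rightarrow> (cpoly \<Rightarrow> cpoly) set"
  where "elementary_aut N =
    {\<phi> \<in> poly_aut N. \<exists>i\<in>{1..N}. \<forall>j\<in>{1..N}. j \<noteq> i \<longrightarrow> \<phi> (X j) = X j}"

definition linear_aut :: "nat \<Rightarrow> (cpoly \<Rightarrow> cpoly) set"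
  where "linear_aut N =
    {\<phi> \<in> poly_aut N. \<forall>i\<in>{1..N}. \<exists>a. \<phi> (X i) = (\<Sum>j\<in>{1..N}. Const (a j) * X j)}"

text \<open>
  Closure under inverses need not be imposed: inverses of elementary and of linear automorphisms
  are again elementary and linear.
\<close>

inductive_set tame_aut :: "nat \<Rightarrow> (cpoly \<Rightarrow> cpoly) set" for N :: nat where
  elementary: "\<phi> \<in> elementary_aut N \<Longrightarrow> \<phi> \<in> tame_aut N"
| linear: "\<phi> \<in> linear_aut N \<Longrightarrow> \<phi> \<in> tame_aut N"
| comp: "\<phi> \<in> tame_aut N \<Longrightarrow> \<psi> \<in> tame_aut N \<Longrightarrow> \<phi> \<circ> \<psi> \<in> tame_aut N"

definition tamely_equivalent :: "nat \<Rightarrow> cpoly set \<Rightarrow> cpoly set \<Rightarrow> bool"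
  where "tamely_equivalent N I J \<longleftrightarrow> (\<exists>\<phi>\<in>tame_aut N. \<phi> ` I = J)"

lemma vars_plus: "vars (p + q) \<subseteq> vars p \<union> vars q"
  unfolding vars_def using Poly_Mapping.keys_add[of p q] by blast

lemma vars_uminus: "vars (- p) = vars p"
  by (simp add: vars_def)

lemma vars_times: "vars (p * q) \<subseteq> vars p \<union> vars q"
proof
  fix x assume "x \<in> vars (p * q)"
  then obtain m where m: "m \<in> Poly_Mapping.keys (p * q)" "x \<in> Poly_Mapping.keys m"
    by (auto simp: vars_def)
  from m(1) obtain a b where ab: "m = a + b" "a \<in> Poly_Mapping.keys p" "b \<in> Poly_Mapping.keys q"
    using keys_mult[of p q] by blast
  have "x \<in> Poly_Mapping.keys a \<union> Poly_Mapping.keys b"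
    using m(2) ab(1) Poly_Mapping.keys_add[of a b] by blast
  with ab show "x \<in> vars p \<union> vars q"
    by (auto simp: vars_def)
qed

lemma vars_Const: "vars (Const c) = {}"
  by (simp add: vars_def Const_def)

lemma vars_X: "vars (X i) = {i}"
  by (simp add: vars_def X_def)

lemma Const_one: "Const 1 = 1"
  by (simp add: Const_def)

lemma cring_poly_ring: "cring (poly_ring n)"
proof (intro cringI abelian_groupI comm_monoidI)
  fix p assume "p \<in> carrier (poly_ring n)"
  then have "- p \<in> carrier (poly_ring n)" "- p \<oplus>\<^bsub>poly_ring n\<^esub> p = \<zero>\<^bsub>poly_ring n\<^esub>"
    by (simp_all add: poly_ring_def vars_uminus)
  then show "\<exists>q\<in>carrier (poly_ring n). q \<oplus>\<^bsub>poly_ring n\<^esub> p = \<zero>\<^bsub>poly_ring n\<^esub>"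
    by blast
qed (use vars_plus vars_times vars_Const[of 1] in
  \<open>fastforce simp: poly_ring_def algebra_simps vars_def Const_one\<close>)+

end

theory Submission
  imports Defs
begin

text \<open>
  Write \<open>x\<close> for the first \<open>n\<close> variables and \<open>y\<close> for the last \<open>n\<close>, let \<open>I\<close> and \<open>J\<close> be the ideals
  of the two varieties, and let \<open>\<alpha>\<close> be an isomorphism from \<open>\<complex>[x]/I\<close> to \<open>\<complex>[x]/J\<close>.  Choose
  polynomials \<open>f\<^sub>i\<close> and \<open>g\<^sub>i\<close> that represent \<open>\<alpha>(x\<^sub>i)\<close> and \<open>\<alpha>\<inverse>(x\<^sub>i)\<close>.  Geometrically, \<open>f\<close> and \<open>g\<close>
  are mutually inverse maps between the two varieties, so that the graph of \<open>g\<close> over \<open>V(I)\<close> is,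
  after exchanging the two factors of \<open>\<complex>\<^sup>n \<times> \<complex>\<^sup>n\<close>, the graph of \<open>f\<close> over \<open>V(J)\<close>.  A graph is
  straightened to \<open>V(I) \<times> 0\<close> by a triangular automorphism, here called a shear, and so
  \<open>V(I) \<times> 0\<close> is taken to \<open>V(J) \<times> 0\<close> by a shear, the exchange of \<open>x\<close> and \<open>y\<close>, and another shear.
  The exchange is linear, and a shear is a product of elementary automorphisms.

  In terms of ideals, let \<open>s\<^sub>g\<close> be the substitution \<open>y := g(x)\<close>.  The ideal of \<open>V(I) \<times> 0\<close> is
  the set of all \<open>p(x,y)\<close> with \<open>s\<^sub>0 p \<in> I\<close> (lemma \<open>genideal_append_vars\<close>), and the ideal of the
  graph of \<open>g\<close> is the set of all \<open>p\<close> with \<open>s\<^sub>g p \<in> I\<close>.  That the exchange matches the two graphs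
  says that \<open>p(g(x), x) \<in> I\<close> holds exactly when \<open>p(x, f(x)) \<in> J\<close> (lemma \<open>graph_ideals_match\<close>): indeed
  \<open>\<alpha>\<close> takes the class of the former polynomial to the class of the latter, because
  \<open>p \<mapsto> \<alpha>(p(g(x), x) + I)\<close> and \<open>p \<mapsto> p(x, f(x)) + J\<close> are algebra homomorphisms with the same values
  on the variables.  Throughout, homomorphisms are compared on variables and constants
  (lemma \<open>poly_ring_hom_eqI\<close>).
\<close>

section \<open>Polynomials are generated by constants and variables\<close>

lemma carrier_poly_ring: "p \<in> carrier (poly_ring n) \<longleftrightarrow> vars p \<subseteq> {1..n}"
  by (simp add: poly_ring_def)

lemma poly_ring_simps [simp]:
  "mult (poly_ring n) = (*)" "add (poly_ring n) = (+)" "one (poly_ring n) = 1" "zero (poly_ring n) = 0"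
  by (simp_all add: poly_ring_def)

lemma Const_0: "Const 0 = 0"
  by (simp add: Const_def)

lemma poly_mapping_eq_sum_single: "p = (\<Sum>m\<in>Poly_Mapping.keys p. Poly_Mapping.single m (Poly_Mapping.lookup p m))"
  for p :: "'a \<Rightarrow>\<^sub>0 'b::comm_monoid_add"
  by (rule poly_mapping_eqI) (simp add: lookup_sum lookup_single when_def in_keys_iff)

lemma single_sum_eq_prod:
  "finite A \<Longrightarrow> Poly_Mapping.single (\<Sum>i\<in>A. m i) (1::complex) = (\<Prod>i\<in>A. Poly_Mapping.single (m i) 1)"
  for m :: "'b \<Rightarrow> nat \<Rightarrow>\<^sub>0 nat"
proof (induction A rule: finite_induct)
  case (insert x A)
  have "Poly_Mapping.single (m x + sum m A) (1::complex) =
      Poly_Mapping.single (m x) 1 * Poly_Mapping.single (sum m A) 1"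
    by (simp add: mult_single)
  then show ?case using insert by simp
qed simp

lemma X_power: "X i ^ k = Poly_Mapping.single (Poly_Mapping.single i k) 1"
  by (induction k) (simp_all add: X_def mult_single single_add[symmetric])

lemma single_eq_Const_mult_prod_X:
  "Poly_Mapping.single m c = Const c * (\<Prod>i\<in>Poly_Mapping.keys m. X i ^ Poly_Mapping.lookup m i)"
proof -
  have "Poly_Mapping.single m c = Const c * Poly_Mapping.single m 1"
    by (simp add: Const_def mult_single)
  also have "Poly_Mapping.single m (1::complex) = (\<Prod>i\<in>Poly_Mapping.keys m. X i ^ Poly_Mapping.lookup m i)"
    by (subst poly_mapping_eq_sum_single[of m], subst single_sum_eq_prod) (simp_all add: X_power)
  finally show ?thesis .
qed

lemma vars_prod_subset: "(\<And>i. i \<in> A \<Longrightarrow> vars (f i) \<subseteq> B) \<Longrightarrow> vars (\<Prod>i\<in>A. f i) \<subseteq> B"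
proof (induction A rule: infinite_finite_induct)
  case (insert a A)
  then have "vars (f a) \<union> vars (\<Prod>i\<in>A. f i) \<subseteq> B" by simp
  then show ?case using vars_times[of "f a" "\<Prod>i\<in>A. f i"] insert.hyps by auto
qed (simp_all add: vars_Const[of 1, unfolded Const_one])

lemma vars_sum_subset: "(\<And>i. i \<in> A \<Longrightarrow> vars (f i) \<subseteq> B) \<Longrightarrow> vars (\<Sum>i\<in>A. f i) \<subseteq> B"
proof (induction A rule: infinite_finite_induct)
  case (insert a A)
  then have "vars (f a) \<union> vars (\<Sum>i\<in>A. f i) \<subseteq> B" by simp
  then show ?case using vars_plus[of "f a" "\<Sum>i\<in>A. f i"] insert.hyps by auto
qed (simp_all add: vars_Const[of 0, unfolded Const_0])

lemma poly_vars_induct [consumes 1, case_names Const X plus times]: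
  assumes vars: "vars p \<subseteq> A"
    and Const: "\<And>c. P (Const c)"
    and X: "\<And>i. i \<in> A \<Longrightarrow> P (X i)"
    and plus: "\<And>p q. vars p \<subseteq> A \<Longrightarrow> vars q \<subseteq> A \<Longrightarrow> P p \<Longrightarrow> P q \<Longrightarrow> P (p + q)"
    and times: "\<And>p q. vars p \<subseteq> A \<Longrightarrow> vars q \<subseteq> A \<Longrightarrow> P p \<Longrightarrow> P q \<Longrightarrow> P (p * q)"
  shows "P p"
proof -
  have P01: "P 0" "P 1" and vars01: "vars 0 = {}" "vars 1 = {}"
    using Const[of 0] Const[of 1] vars_Const[of 0] vars_Const[of 1] by (simp_all add: Const_0 Const_one)
  have power: "P (X i ^ k) \<and> vars (X i ^ k) \<subseteq> A" if "i \<in> A" for i k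
  proof (induction k)
    case (Suc k)
    then show ?case
      using times[of "X i" "X i ^ k"] X[OF that] vars_X[of i] that vars_times[of "X i" "X i ^ k"]
      by auto
  qed (simp add: P01 vars01)
  have prod: "P (\<Prod>i\<in>B. X i ^ k i)" if "B \<subseteq> A" for B k
    using that
  proof (induction B rule: infinite_finite_induct)
    case (insert b B)
    have "vars (\<Prod>i\<in>B. X i ^ k i) \<subseteq> A"
      by (rule vars_prod_subset) (use insert.prems power in blast)
    then show ?case using insert power[of b "k b"] by (simp add: times)
  qed (simp_all add: P01)
  have monom: "P (Poly_Mapping.single m c) \<and> vars (Poly_Mapping.single m c) \<subseteq> A"
    if "m \<in> Poly_Mapping.keys p" for m c
  proof -
    have m: "Poly_Mapping.keys m \<subseteq> A" using that vars by (auto simp: vars_def)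
    then have v: "vars (\<Prod>i\<in>Poly_Mapping.keys m. X i ^ Poly_Mapping.lookup m i) \<subseteq> A"
      by (intro vars_prod_subset) (use power in blast)
    have "P (Poly_Mapping.single m c)"
      unfolding single_eq_Const_mult_prod_X by (rule times) (use v m in \<open>simp_all add: vars_Const Const prod\<close>)
    moreover have "vars (Poly_Mapping.single m c) \<subseteq> A"
      using m by (simp add: vars_def split: if_splits)
    ultimately show ?thesis by blast
  qed
  have "P (\<Sum>m\<in>B. Poly_Mapping.single m (Poly_Mapping.lookup p m))" if "B \<subseteq> Poly_Mapping.keys p" for B
    using that
  proof (induction B rule: infinite_finite_induct)
    case (insert b B)
    have "vars (\<Sum>m\<in>B. Poly_Mapping.single m (Poly_Mapping.lookup p m)) \<subseteq> A"
      by (rule vars_sum_subset) (use insert.prems monom in blast)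
    then show ?case using insert monom[of b "Poly_Mapping.lookup p b"] by (simp add: plus)
  qed (simp_all add: P01)
  from this[OF subset_refl] show ?thesis
    by (simp add: poly_mapping_eq_sum_single[symmetric])
qed

text \<open>
  The codomain is arbitrary, so that this compares substitutions as well as maps into coordinate
  rings.
\<close>

lemma poly_ring_hom_eqI:
  assumes f: "f \<in> ring_hom (poly_ring N) R" and g: "g \<in> ring_hom (poly_ring N) R"
    and Const: "\<And>c. f (Const c) = g (Const c)"
    and X: "\<And>i. i \<in> {1..N} \<Longrightarrow> f (X i) = g (X i)"
    and p: "p \<in> carrier (poly_ring N)"
  shows "f p = g p"
  using p unfolding carrier_poly_ring
proof (induction rule: poly_vars_induct)
  case (plus p q)
  then show ?case
    using ring_hom_add[OF f, of p q] ring_hom_add[OF g, of p q] by (simp add: carrier_poly_ring)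
next
  case (times p q)
  then show ?case
    using ring_hom_mult[OF f, of p q] ring_hom_mult[OF g, of p q] by (simp add: carrier_poly_ring)
qed (simp_all add: Const X)

section \<open>Substitution\<close>

definition subst_monom :: "(nat \<Rightarrow> cpoly) \<Rightarrow> (nat \<Rightarrow>\<^sub>0 nat) \<Rightarrow> cpoly"
  where "subst_monom \<sigma> m = (\<Prod>i\<in>Poly_Mapping.keys m. \<sigma> i ^ Poly_Mapping.lookup m i)"

definition subst :: "(nat \<Rightarrow> cpoly) \<Rightarrow> cpoly \<Rightarrow> cpoly"
  where "subst \<sigma> p = (\<Sum>m\<in>Poly_Mapping.keys p. Const (Poly_Mapping.lookup p m) * subst_monom \<sigma> m)"

lemma subst_monom_superset:
  "finite A \<Longrightarrow> Poly_Mapping.keys m \<subseteq> A \<Longrightarrow> subst_monom \<sigma> m = (\<Prod>i\<in>A. \<sigma> i ^ Poly_Mapping.lookup m i)"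
  unfolding subst_monom_def by (rule prod.mono_neutral_left) (auto simp: in_keys_iff)

lemma subst_superset:
  "finite A \<Longrightarrow> Poly_Mapping.keys p \<subseteq> A \<Longrightarrow>
    subst \<sigma> p = (\<Sum>m\<in>A. Const (Poly_Mapping.lookup p m) * subst_monom \<sigma> m)"
  unfolding subst_def by (rule sum.mono_neutral_left) (auto simp: in_keys_iff Const_0)

lemma subst_monom_add: "subst_monom \<sigma> (a + b) = subst_monom \<sigma> a * subst_monom \<sigma> b"
proof -
  let ?A = "Poly_Mapping.keys a \<union> Poly_Mapping.keys b"
  have "subst_monom \<sigma> m = (\<Prod>i\<in>?A. \<sigma> i ^ Poly_Mapping.lookup m i)" if "m \<in> {a, b, a + b}" for m
    by (rule subst_monom_superset) (use that Poly_Mapping.keys_add[of a b] in auto)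
  then show ?thesis
    by (simp add: lookup_add power_add prod.distrib)
qed

lemma subst_add: "subst \<sigma> (p + q) = subst \<sigma> p + subst \<sigma> q"
proof -
  let ?A = "Poly_Mapping.keys p \<union> Poly_Mapping.keys q"
  have "subst \<sigma> r = (\<Sum>m\<in>?A. Const (Poly_Mapping.lookup r m) * subst_monom \<sigma> m)" if "r \<in> {p, q, p + q}" for r
    by (rule subst_superset) (use that Poly_Mapping.keys_add[of p q] in auto)
  then show ?thesis
    by (simp add: lookup_add Const_def single_add distrib_right sum.distrib)
qed

lemma subst_single: "subst \<sigma> (Poly_Mapping.single m c) = Const c * subst_monom \<sigma> m"
  by (cases "c = 0") (simp_all add: subst_def Const_0)

lemma subst_0 [simp]: "subst \<sigma> 0 = 0"
  by (simp add: subst_def)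

lemma subst_sum: "subst \<sigma> (\<Sum>i\<in>A. f i) = (\<Sum>i\<in>A. subst \<sigma> (f i))"
  by (induction A rule: infinite_finite_induct) (simp_all add: subst_add)

lemma subst_mult: "subst \<sigma> (p * q) = subst \<sigma> p * subst \<sigma> q"
proof -
  let ?s = "\<lambda>r m. Poly_Mapping.single m (Poly_Mapping.lookup r m)"
  have *: "subst \<sigma> (?s p a * ?s q b) = subst \<sigma> (?s p a) * subst \<sigma> (?s q b)" for a b
  proof -
    have "Const (Poly_Mapping.lookup p a * Poly_Mapping.lookup q b) = Const (Poly_Mapping.lookup p a) * Const (Poly_Mapping.lookup q b)"
      by (simp add: Const_def mult_single)
    then show ?thesis by (simp add: mult_single subst_single subst_monom_add)
  qed
  have "p * q = (\<Sum>a\<in>Poly_Mapping.keys p. \<Sum>b\<in>Poly_Mapping.keys q. ?s p a * ?s q b)"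
    by (simp add: sum_product[symmetric] poly_mapping_eq_sum_single[symmetric])
  also have "subst \<sigma> \<dots> = subst \<sigma> (\<Sum>a\<in>Poly_Mapping.keys p. ?s p a) * subst \<sigma> (\<Sum>b\<in>Poly_Mapping.keys q. ?s q b)"
    by (simp add: subst_sum * sum_product)
  finally show ?thesis by (simp add: poly_mapping_eq_sum_single[symmetric])
qed

lemma subst_Const [simp]: "subst \<sigma> (Const c) = Const c"
  unfolding Const_def by (subst subst_single) (simp add: subst_monom_def Const_def)

lemma subst_X [simp]: "subst \<sigma> (X i) = \<sigma> i"
  unfolding X_def by (subst subst_single) (simp add: subst_monom_def Const_one)

lemma subst_ident: "vars p \<subseteq> A \<Longrightarrow> (\<And>i. i \<in> A \<Longrightarrow> \<sigma> i = X i) \<Longrightarrow> subst \<sigma> p = p"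
  by (induction rule: poly_vars_induct) (simp_all add: subst_add subst_mult)

lemma subst_subst: "subst \<sigma> (subst \<tau> p) = subst (\<lambda>i. subst \<sigma> (\<tau> i)) p"
  by (rule poly_vars_induct[of p UNIV]) (simp_all add: subst_add subst_mult)

lemma vars_subst_subset:
  "vars p \<subseteq> A \<Longrightarrow> (\<And>i. i \<in> A \<Longrightarrow> vars (\<sigma> i) \<subseteq> B) \<Longrightarrow> vars (subst \<sigma> p) \<subseteq> B"
proof (induction rule: poly_vars_induct)
  case (plus p q)
  then show ?case using vars_plus[of "subst \<sigma> p" "subst \<sigma> q"] by (simp add: subst_add) blast
next
  case (times p q)
  then show ?case using vars_times[of "subst \<sigma> p" "subst \<sigma> q"] by (simp add: subst_mult) blast
qed (simp_all add: vars_Const)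

lemma subst_ring_hom:
  assumes "\<And>i. i \<in> {1..N} \<Longrightarrow> vars (\<sigma> i) \<subseteq> {1..M}"
  shows "subst \<sigma> \<in> ring_hom (poly_ring N) (poly_ring M)"
  by (rule ring_hom_memI)
    (use assms vars_subst_subset[of _ "{1..N}" \<sigma> "{1..M}"] subst_Const[of \<sigma> 1, unfolded Const_one] in
      \<open>simp_all add: carrier_poly_ring subst_add subst_mult\<close>)

section \<open>Tame automorphisms\<close>

lemma subst_poly_aut:
  assumes \<sigma>: "\<And>i. i \<in> {1..N} \<Longrightarrow> vars (\<sigma> i) \<subseteq> {1..N}"
    and \<tau>: "\<And>i. i \<in> {1..N} \<Longrightarrow> vars (\<tau> i) \<subseteq> {1..N}"
    and \<sigma>\<tau>: "\<And>i. i \<in> {1..N} \<Longrightarrow> subst \<sigma> (\<tau> i) = X i"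
    and \<tau>\<sigma>: "\<And>i. i \<in> {1..N} \<Longrightarrow> subst \<tau> (\<sigma> i) = X i"
  shows "subst \<sigma> \<in> poly_aut N"
proof -
  have homs: "subst \<sigma> \<in> ring_hom (poly_ring N) (poly_ring N)" "subst \<tau> \<in> ring_hom (poly_ring N) (poly_ring N)"
    by (rule subst_ring_hom, erule \<sigma>) (rule subst_ring_hom, erule \<tau>)
  have "bij_betw (subst \<sigma>) (carrier (poly_ring N)) (carrier (poly_ring N))"
  proof (rule bij_betw_byWitness[where f' = "subst \<tau>"])
    show "\<forall>p\<in>carrier (poly_ring N). subst \<tau> (subst \<sigma> p) = p"
      by (simp only: carrier_poly_ring subst_subst) (intro ballI subst_ident[where A = "{1..N}"], simp_all only: mem_Collect_eq carrier_poly_ring \<tau>\<sigma>)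
    show "\<forall>p\<in>carrier (poly_ring N). subst \<sigma> (subst \<tau> p) = p"
      by (simp only: carrier_poly_ring subst_subst) (intro ballI subst_ident[where A = "{1..N}"], simp_all only: mem_Collect_eq carrier_poly_ring \<sigma>\<tau>)
  qed (use ring_hom_closed[OF homs(1)] ring_hom_closed[OF homs(2)] in blast)+
  then show ?thesis
    using homs by (simp add: poly_aut_def alg_iso_def ring_iso_def)
qed

lemma tame_aut_subset_poly_aut: "tame_aut N \<subseteq> poly_aut N"
proof
  fix \<phi> assume "\<phi> \<in> tame_aut N"
  then show "\<phi> \<in> poly_aut N"
  proof induction
    case (comp \<phi> \<psi>)
    then have "\<phi> \<circ> \<psi> \<in> ring_iso (poly_ring N) (poly_ring N)"
      by (intro ring_iso_set_trans) (auto simp: poly_aut_def alg_iso_def)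
    then show ?case using comp.IH unfolding poly_aut_def alg_iso_def mem_Collect_eq comp_apply by metis
  qed (simp_all add: elementary_aut_def linear_aut_def)
qed

lemma linear_aut_variable_involution:
  assumes \<pi>: "\<And>i. i \<in> {1..N} \<Longrightarrow> \<pi> i \<in> {1..N}" and inv: "\<And>i. i \<in> {1..N} \<Longrightarrow> \<pi> (\<pi> i) = i"
  shows "subst (\<lambda>i. X (\<pi> i)) \<in> linear_aut N"
proof -
  have "X (\<pi> i) = (\<Sum>j\<in>{1..N}. Const (if j = \<pi> i then 1 else 0) * X j)" if "i \<in> {1..N}" for i
  proof -
    have "(\<Sum>j\<in>{1..N}. Const (if j = \<pi> i then 1 else 0) * X j) = (\<Sum>j\<in>{1..N}. if j = \<pi> i then X j else 0)"
      by (rule sum.cong) (simp_all add: Const_0 Const_one)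
    then show ?thesis using \<pi>[OF that] by (simp add: sum.delta)
  qed
  then have "\<exists>a. X (\<pi> i) = (\<Sum>j\<in>{1..N}. Const (a j) * X j)" if "i \<in> {1..N}" for i
    using that by (intro exI[where x = "\<lambda>j. if j = \<pi> i then 1 else 0"])
  moreover have "subst (\<lambda>i. X (\<pi> i)) \<in> poly_aut N"
    by (rule subst_poly_aut[where \<tau> = "\<lambda>i. X (\<pi> i)"]) (use assms in \<open>simp_all add: vars_X\<close>)
  ultimately show ?thesis by (simp add: linear_aut_def)
qed

definition shear :: "nat set \<Rightarrow> (nat \<Rightarrow> cpoly) \<Rightarrow> cpoly \<Rightarrow> cpoly"
  where "shear K h = subst (override_on X (\<lambda>i. X i + h i) K)"

text \<open>
  The polynomials added to the variables in \<open>K\<close> do not involve variables in \<open>K\<close>, so the variables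
  can be changed one at a time.
\<close>

lemma shear_tame:
  assumes "K \<subseteq> {1..N}" and "\<And>i. i \<in> K \<Longrightarrow> vars (h i) \<subseteq> {1..N} - K"
  shows "shear K h \<in> tame_aut N"
proof -
  have "finite K" using assms(1) finite_subset by blast
  then show ?thesis using assms
  proof (induction K rule: finite_induct)
    case empty
    \<comment> \<open>The identity counts as linear; for \<open>N = 0\<close> there are no elementary automorphisms.\<close>
    have "subst (\<lambda>i. X (id i)) \<in> linear_aut N" by (rule linear_aut_variable_involution) simp_all
    then show ?case by (simp add: shear_def tame_aut.linear)
  next
    case (insert k K)
    have hk: "vars (h k) \<subseteq> {1..N} - {k}" using insert.prems(2)[of k] by auto
    have k: "k \<in> {1..N}" using insert.prems(1) by simp
    \<comment> \<open>Applied with \<open>h\<close> and \<open>- h\<close> in both orders: shears by opposite polynomials are inverse.\<close>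
    have inverse: "subst (override_on X (\<lambda>i. X i + a i) {k}) (override_on X (\<lambda>i. X i + b i) {k} i) = X i"
      if "a k = - b k" "vars (b k) \<subseteq> {1..N} - {k}" for a b i
    proof -
      have "subst (override_on X (\<lambda>i. X i + a i) {k}) (b k) = b k"
        by (rule subst_ident[OF that(2)]) simp
      then show ?thesis using that(1) by (simp add: override_on_def subst_add)
    qed
    have closed: "vars (override_on X (\<lambda>i. X i + a i) {k} i) \<subseteq> {1..N}"
      if "vars (a k) \<subseteq> {1..N} - {k}" "i \<in> {1..N}" for a i
      using that vars_plus[of "X i" "a i"] by (auto simp: override_on_def vars_X)
    have "shear {k} h \<in> poly_aut N"
      unfolding shear_def
      by (rule subst_poly_aut[where \<tau> = "override_on X (\<lambda>i. X i + (- h i)) {k}"])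
        (use inverse[of h "\<lambda>i. - h i"] inverse[of "\<lambda>i. - h i" h] closed[of h] closed[of "\<lambda>i. - h i"] hk in
          \<open>simp_all add: vars_uminus\<close>)
    moreover have "shear {k} h (X j) = X j" if "j \<noteq> k" for j
      using that by (simp add: shear_def)
    ultimately have "shear {k} h \<in> elementary_aut N"
      using k unfolding elementary_aut_def by blast
    moreover have "shear K h \<in> tame_aut N"
      by (rule insert.IH) (use insert.prems in auto)
    ultimately have "shear {k} h \<circ> shear K h \<in> tame_aut N"
      by (blast intro: tame_aut.comp tame_aut.elementary)
    moreover have "shear {k} h \<circ> shear K h = shear (insert k K) h"
    proof
      fix p
      have "subst (override_on X (\<lambda>i. X i + h i) {k}) (h i) = h i" if "i \<in> K" for i
        by (rule subst_ident[where A = "{1..N} - insert k K"]) (use insert.prems(2)[of i] that in auto)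
      then have "(\<lambda>i. subst (override_on X (\<lambda>i. X i + h i) {k}) (override_on X (\<lambda>i. X i + h i) K i)) =
          override_on X (\<lambda>i. X i + h i) (insert k K)"
        using insert.hyps by (auto simp: fun_eq_iff override_on_def subst_add)
      then show "(shear {k} h \<circ> shear K h) p = shear (insert k K) h p"
        by (simp add: shear_def subst_subst)
    qed
    ultimately show ?case by simp
  qed
qed

section \<open>Ideals\<close>

lemma V_ideal: "set ps \<subseteq> carrier (poly_ring n) \<Longrightarrow> ideal (V n ps) (poly_ring n)"
  unfolding V_def by (rule ring.genideal_ideal[OF cring.axioms(1)[OF cring_poly_ring]])

lemma zero_mem_ideal: "ideal I (poly_ring n) \<Longrightarrow> 0 \<in> I"
  using additive_subgroup.zero_closed[OF ideal.axioms(1), of I "poly_ring n"] by simp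

lemma V_self: "set ps \<subseteq> carrier (poly_ring n) \<Longrightarrow> set ps \<subseteq> V n ps"
  unfolding V_def by (rule ring.genideal_self[OF cring.axioms(1)[OF cring_poly_ring]])

lemma V_minimal: "ideal I (poly_ring n) \<Longrightarrow> set ps \<subseteq> I \<Longrightarrow> V n ps \<subseteq> I"
  unfolding V_def by (rule ring.genideal_minimal[OF cring.axioms(1)[OF cring_poly_ring]])

lemma ideal_vimage_poly_ring:
  assumes "h \<in> ring_hom (poly_ring N) (poly_ring M)" and "ideal I (poly_ring M)"
  shows "ideal {p \<in> carrier (poly_ring N). h p \<in> I} (poly_ring N)"
  by (rule ring_hom_ring.ideal_vimage[OF ring_hom_ringI2])
    (use assms cring.axioms(1)[OF cring_poly_ring] in auto)

text \<open>
  Modulo an ideal that contains the last \<open>n\<close> variables, every polynomial is congruent to the one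
  obtained by setting these variables to \<open>0\<close>; so such an ideal is determined by the polynomials
  in the first \<open>n\<close> variables that it contains.
\<close>

lemma genideal_append_vars:
  assumes ps: "set ps \<subseteq> carrier (poly_ring n)"
  shows "V (2 * n) (ps @ map X [n + 1..<2 * n + 1]) =
    {p \<in> carrier (poly_ring (2 * n)). subst (override_on X (\<lambda>_. 0) {n + 1..2 * n}) p \<in> V n ps}"
    (is "?V = {p \<in> ?C. ?s p \<in> ?I}")
proof
  let ?P = "poly_ring (2 * n)"
  have vars_0: "vars 0 = {}" using vars_Const[of 0] by (simp add: Const_0)
  have hom: "?s \<in> ring_hom ?P (poly_ring n)"
    by (rule subst_ring_hom) (auto simp: override_on_def vars_X vars_0)
  have set_eq: "set (ps @ map X [n + 1..<2 * n + 1]) = set ps \<union> X ` {n + 1..2 * n}"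
    by (simp add: atLeastLessThanSuc_atLeastAtMost del: upt_Suc)
  have gens: "set (ps @ map X [n + 1..<2 * n + 1]) \<subseteq> ?C"
    using ps by (fastforce simp: carrier_poly_ring vars_X)
  interpret I: ideal ?I "poly_ring n" by (rule V_ideal[OF ps])
  interpret V: ideal ?V ?P by (rule V_ideal[OF gens])
  have s_ident: "?s p = p" if "p \<in> carrier (poly_ring n)" for p
    using that by (intro subst_ident[where A = "{1..n}"]) (simp_all add: carrier_poly_ring)
  show "?V \<subseteq> {p \<in> ?C. ?s p \<in> ?I}"
  proof (rule V_minimal)
    show "ideal {p \<in> ?C. ?s p \<in> ?I} ?P" by (rule ideal_vimage_poly_ring[OF hom I.ideal_axioms])
    have "?s p \<in> ?I" if "p \<in> set ps" for p
      using that ps V_self[OF ps] s_ident[of p] by auto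
    moreover have "?s (X i) \<in> ?I" if "i \<in> {n + 1..2 * n}" for i
      using that zero_mem_ideal[OF I.ideal_axioms] by simp
    ultimately show "set (ps @ map X [n + 1..<2 * n + 1]) \<subseteq> {p \<in> ?C. ?s p \<in> ?I}"
      using gens unfolding set_eq by blast
  qed
  have id_hom: "id \<in> ring_hom (poly_ring n) ?P"
    by (rule ring_hom_memI) (auto simp: carrier_poly_ring)
  have "?I \<subseteq> {p \<in> carrier (poly_ring n). id p \<in> ?V}"
    by (rule V_minimal[OF ideal_vimage_poly_ring[OF id_hom V.ideal_axioms]])
      (use ps V_self[OF gens] in auto)
  then have I_subset: "?I \<subseteq> ?V" by auto
  have congruent: "?V +>\<^bsub>?P\<^esub> p = ?V +>\<^bsub>?P\<^esub> ?s p" if "p \<in> ?C" for p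
  proof (rule poly_ring_hom_eqI[OF V.rcos_ring_hom _ _ _ that, where g = "\<lambda>p. ?V +>\<^bsub>?P\<^esub> ?s p"])
    show "(\<lambda>p. ?V +>\<^bsub>?P\<^esub> ?s p) \<in> ring_hom ?P (?P Quot ?V)"
      using ring_hom_trans[OF ring_hom_trans[OF hom id_hom] V.rcos_ring_hom] by (simp add: comp_def)
    show "?V +>\<^bsub>?P\<^esub> X i = ?V +>\<^bsub>?P\<^esub> ?s (X i)" if "i \<in> {1..2 * n}" for i
    proof (cases "i \<in> {n + 1..2 * n}")
      case True
      then have "X i \<in> ?V" using V_self[OF gens] unfolding set_eq by blast
      then show ?thesis
        using True V.a_rcos_const[of "X i"] V.a_rcos_const[of 0] zero_mem_ideal[OF V.ideal_axioms] by simp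
    qed simp
  qed simp
  show "{p \<in> ?C. ?s p \<in> ?I} \<subseteq> ?V"
  proof clarify
    fix p assume p: "p \<in> ?C" and "?s p \<in> ?I"
    then have "?V +>\<^bsub>?P\<^esub> p = ?V"
      using congruent[OF p] V.a_rcos_const[of "?s p"] I_subset by auto
    then show "p \<in> ?V" using V.a_rcos_self[OF p] by simp
  qed
qed

definition swap_halves :: "nat \<Rightarrow> cpoly \<Rightarrow> cpoly"
  where "swap_halves n = subst (\<lambda>i. X (if i \<le> n then i + n else i - n))"

text \<open>
  If \<open>f\<close> and \<open>g\<close> induce an isomorphism and its inverse on the coordinate rings, then the graph of
  \<open>g\<close> over the first variety and the graph of \<open>f\<close> over the second are mirror images.
  Membership in \<open>I\<close> and in \<open>J\<close> is expressed by equality with the coset of \<open>0\<close>, which is the value of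
  the structure map at \<open>0\<close> and hence preserved by the isomorphism.
\<close>

lemma graph_ideals_match:
  assumes I: "ideal I (poly_ring n)" and J: "ideal J (poly_ring n)"
    and \<alpha>: "\<alpha> \<in> alg_iso (coordinate_ring n I) (coordinate_const n I) (coordinate_ring n J) (coordinate_const n J)"
    and f: "\<And>i. i \<in> {n + 1..2 * n} \<Longrightarrow> f i \<in> carrier (poly_ring n) \<and> \<alpha> (I +>\<^bsub>poly_ring n\<^esub> X (i - n)) = J +>\<^bsub>poly_ring n\<^esub> f i"
    and g: "\<And>i. i \<in> {n + 1..2 * n} \<Longrightarrow> g i \<in> carrier (poly_ring n) \<and> \<alpha> (I +>\<^bsub>poly_ring n\<^esub> g i) = J +>\<^bsub>poly_ring n\<^esub> X (i - n)"
    and p: "p \<in> carrier (poly_ring (2 * n))"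
  shows "subst (override_on X g {n + 1..2 * n}) (swap_halves n p) \<in> I \<longleftrightarrow>
    subst (override_on X f {n + 1..2 * n}) p \<in> J"
    (is "?sg (swap_halves n p) \<in> I \<longleftrightarrow> ?sf p \<in> J")
proof -
  let ?P = "poly_ring n" and ?P2 = "poly_ring (2 * n)"
  interpret I: ideal I ?P by fact
  interpret J: ideal J ?P by fact
  have \<alpha>_hom: "\<alpha> \<in> ring_hom (?P Quot I) (?P Quot J)" and \<alpha>_inj: "inj_on \<alpha> (carrier (?P Quot I))"
    and \<alpha>_Const: "\<And>c. \<alpha> (I +>\<^bsub>?P\<^esub> Const c) = J +>\<^bsub>?P\<^esub> Const c"
    using \<alpha> by (auto simp: alg_iso_def ring_iso_def coordinate_ring_def coordinate_const_def bij_betw_def)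
  have sf: "?sf \<in> ring_hom ?P2 ?P"
    by (rule subst_ring_hom) (use f in \<open>auto simp: override_on_def vars_X carrier_poly_ring\<close>)
  have sg: "?sg \<in> ring_hom ?P2 ?P"
    by (rule subst_ring_hom) (use g in \<open>auto simp: override_on_def vars_X carrier_poly_ring\<close>)
  have swap: "swap_halves n \<in> ring_hom ?P2 ?P2"
    unfolding swap_halves_def by (rule subst_ring_hom) (auto simp: vars_X)
  let ?a = "?sg (swap_halves n p)" and ?b = "?sf p"
  have ab: "?a \<in> carrier ?P" "?b \<in> carrier ?P"
    using ring_hom_closed[OF sg ring_hom_closed[OF swap p]] ring_hom_closed[OF sf p] by auto
  have eq: "\<alpha> (I +>\<^bsub>?P\<^esub> ?a) = J +>\<^bsub>?P\<^esub> ?b"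
  proof (rule poly_ring_hom_eqI[OF _ _ _ _ p, where R = "?P Quot J"
        and f = "\<lambda>p. \<alpha> (I +>\<^bsub>?P\<^esub> ?sg (swap_halves n p))" and g = "\<lambda>p. J +>\<^bsub>?P\<^esub> ?sf p"])
    show "(\<lambda>p. \<alpha> (I +>\<^bsub>?P\<^esub> ?sg (swap_halves n p))) \<in> ring_hom ?P2 (?P Quot J)"
      using ring_hom_trans[OF swap ring_hom_trans[OF sg ring_hom_trans[OF I.rcos_ring_hom \<alpha>_hom]]]
      by (simp add: comp_def)
    show "(\<lambda>p. J +>\<^bsub>?P\<^esub> ?sf p) \<in> ring_hom ?P2 (?P Quot J)"
      using ring_hom_trans[OF sf J.rcos_ring_hom] by (simp add: comp_def)
    show "\<alpha> (I +>\<^bsub>?P\<^esub> ?sg (swap_halves n (Const c))) = J +>\<^bsub>?P\<^esub> ?sf (Const c)" for c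
      by (simp add: swap_halves_def \<alpha>_Const)
    show "\<alpha> (I +>\<^bsub>?P\<^esub> ?sg (swap_halves n (X i))) = J +>\<^bsub>?P\<^esub> ?sf (X i)" if "i \<in> {1..2 * n}" for i
    proof (cases "i \<le> n")
      case True
      then show ?thesis using that g[of "i + n"] by (simp add: swap_halves_def override_on_def)
    next
      case False
      moreover have "i - n \<le> n" using that by (simp add: le_diff_conv)
      ultimately show ?thesis using that f[of i] by (simp add: swap_halves_def override_on_def)
    qed
  qed
  have zero: "\<alpha> I = J"
    using \<alpha>_Const[of 0] I.a_rcos_const[of 0] J.a_rcos_const[of 0] zero_mem_ideal[OF I] zero_mem_ideal[OF J]
    by (simp add: Const_0)
  have "?a \<in> I \<longleftrightarrow> I +>\<^bsub>?P\<^esub> ?a = I"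
    using I.a_rcos_const I.a_rcos_self[OF ab(1)] by auto
  also have "\<dots> \<longleftrightarrow> \<alpha> (I +>\<^bsub>?P\<^esub> ?a) = \<alpha> I"
  proof -
    have "I +>\<^bsub>?P\<^esub> ?a \<in> carrier (?P Quot I)" "I +>\<^bsub>?P\<^esub> 0 \<in> carrier (?P Quot I)"
      using ring_hom_closed[OF I.rcos_ring_hom] ab(1) zero_mem_ideal[OF I] I.a_Hcarr by auto
    then show ?thesis
      using inj_on_eq_iff[OF \<alpha>_inj] I.a_rcos_const[of 0] zero_mem_ideal[OF I] by simp
  qed
  also have "\<dots> \<longleftrightarrow> ?b \<in> J"
    unfolding eq zero using J.a_rcos_const J.a_rcos_self[OF ab(2)] by auto
  finally show ?thesis .
qed

section \<open>Isomorphic varieties become tamely equivalent\<close>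

text \<open>
  As a map of points, a shear by \<open>h\<close> translates a graph by \<open>h\<close>.  Shearing by \<open>f\<close> turns the zero section into the graph
  of \<open>f\<close>, and shearing by \<open>- g\<close> turns the graph of \<open>g\<close> back into the zero section.
\<close>

lemma subst_graph_shear:
  assumes "\<And>i. i \<in> K \<Longrightarrow> vars (h i) \<inter> K = {}"
    and "\<And>i. i \<in> K \<Longrightarrow> b i = a i + h i"
  shows "subst (override_on X a K) (shear K h p) = subst (override_on X b K) p"
proof -
  have "subst (override_on X a K) (h i) = h i" if "i \<in> K" for i
    by (rule subst_ident[OF subset_refl]) (use assms(1)[OF that] in \<open>auto simp: override_on_def\<close>)
  then have "(\<lambda>i. subst (override_on X a K) (override_on X (\<lambda>i. X i + h i) K i)) = override_on X b K"
    using assms(2) by (auto simp: fun_eq_iff override_on_def subst_add)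
  then show ?thesis by (simp add: shear_def subst_subst)
qed

theorem corollary1p2:
  fixes n :: nat and ps qs :: "cpoly list"
  assumes "set ps \<subseteq> carrier (poly_ring n)"
    and "set qs \<subseteq> carrier (poly_ring n)"
    and "isomorphic_varieties n (V n ps) (V n qs)"
  shows "tamely_equivalent (2 * n)
           (V (2 * n) (ps @ map X [n + 1..<2 * n + 1]))
           (V (2 * n) (qs @ map X [n + 1..<2 * n + 1]))"
proof -
  let ?P = "poly_ring n" and ?P2 = "poly_ring (2 * n)" and ?K = "{n + 1..2 * n}"
  define I where "I = V n ps"
  define J where "J = V n qs"
  have I: "ideal I ?P" and J: "ideal J ?P"
    unfolding I_def J_def by (intro V_ideal assms)+
  obtain \<alpha> where \<alpha>: "\<alpha> \<in> alg_iso (coordinate_ring n I) (coordinate_const n I) (coordinate_ring n J) (coordinate_const n J)"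
    using assms(3) unfolding isomorphic_varieties_def I_def J_def by blast
  then have bij: "bij_betw \<alpha> (carrier (?P Quot I)) (carrier (?P Quot J))"
    by (simp add: alg_iso_def ring_iso_def coordinate_ring_def)
  have X_carrier: "X (i - n) \<in> carrier ?P" if "i \<in> ?K" for i
    using that by (auto simp: carrier_poly_ring vars_X)
  have carrier_Quot: "carrier (?P Quot A) = (\<lambda>p. A +>\<^bsub>?P\<^esub> p) ` carrier ?P" for A
    unfolding FactRing_def A_RCOSETS_defs a_r_coset_def by auto
  \<comment> \<open>The families \<open>f\<close> and \<open>g\<close> are indexed by the variables \<open>y\<close> that they replace: \<open>f i\<close> represents the
    image of the variable of index \<open>i - n\<close>.\<close>
  have "\<exists>q\<in>carrier ?P. \<alpha> (I +>\<^bsub>?P\<^esub> X (i - n)) = J +>\<^bsub>?P\<^esub> q" if "i \<in> ?K" for i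
    using bij X_carrier[OF that] unfolding bij_betw_def carrier_Quot by blast
  then obtain f where f: "\<And>i. i \<in> ?K \<Longrightarrow> f i \<in> carrier ?P \<and> \<alpha> (I +>\<^bsub>?P\<^esub> X (i - n)) = J +>\<^bsub>?P\<^esub> f i"
    by metis
  have "\<exists>q\<in>carrier ?P. \<alpha> (I +>\<^bsub>?P\<^esub> q) = J +>\<^bsub>?P\<^esub> X (i - n)" if "i \<in> ?K" for i
  proof -
    have "J +>\<^bsub>?P\<^esub> X (i - n) \<in> \<alpha> ` (\<lambda>p. I +>\<^bsub>?P\<^esub> p) ` carrier ?P"
      using bij X_carrier[OF that] unfolding bij_betw_def carrier_Quot by blast
    then show ?thesis by auto
  qed
  then obtain g where g: "\<And>i. i \<in> ?K \<Longrightarrow> g i \<in> carrier ?P \<and> \<alpha> (I +>\<^bsub>?P\<^esub> g i) = J +>\<^bsub>?P\<^esub> X (i - n)"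
    by metis
  have vars_fg: "vars (f i) \<subseteq> {1..2 * n} - ?K" "vars (g i) \<subseteq> {1..2 * n} - ?K" if "i \<in> ?K" for i
    using f[OF that] g[OF that] by (fastforce simp: carrier_poly_ring)+
  \<comment> \<open>On ideals, the shear by \<open>- g\<close> takes \<open>I + (y)\<close> to the ideal of the graph
    of \<open>g\<close>; the exchange turns this into the ideal of the graph of \<open>f\<close>, and the shear by \<open>f\<close> takes that
    one to \<open>J + (y)\<close>.\<close>
  define \<phi> where "\<phi> = shear ?K f \<circ> swap_halves n \<circ> shear ?K (\<lambda>i. - g i)"
  have shear_g: "shear ?K (\<lambda>i. - g i) \<in> tame_aut (2 * n)" and shear_f: "shear ?K f \<in> tame_aut (2 * n)"
    by (rule shear_tame; use vars_fg in \<open>force simp: vars_uminus\<close>)+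
  have swap: "swap_halves n \<in> tame_aut (2 * n)"
    unfolding swap_halves_def by (intro tame_aut.linear linear_aut_variable_involution) auto
  have tame: "\<phi> \<in> tame_aut (2 * n)"
    unfolding \<phi>_def by (intro tame_aut.comp shear_g shear_f swap)
  have closed: "\<psi> p \<in> carrier ?P2" if "\<psi> \<in> tame_aut (2 * n)" "p \<in> carrier ?P2" for \<psi> p
    using that tame_aut_subset_poly_aut ring_hom_closed
    by (fastforce simp: poly_aut_def alg_iso_def ring_iso_def)
  \<comment> \<open>As \<open>\<phi>\<close> permutes the carrier, this equivalence gives both inclusions without its inverse.\<close>
  have mem_iff: "p \<in> V (2 * n) (ps @ map X [n + 1..<2 * n + 1]) \<longleftrightarrow>
      \<phi> p \<in> V (2 * n) (qs @ map X [n + 1..<2 * n + 1])" if p: "p \<in> carrier ?P2" for p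
  proof -
    define q where "q = shear ?K (\<lambda>i. - g i) p"
    have q: "q \<in> carrier ?P2" unfolding q_def by (rule closed[OF shear_g p])
    have swap_swap: "swap_halves n (swap_halves n q) = q"
      using q unfolding swap_halves_def carrier_poly_ring
      by (subst subst_subst, intro subst_ident) auto
    have "\<phi> p \<in> V (2 * n) (qs @ map X [n + 1..<2 * n + 1]) \<longleftrightarrow>
        subst (override_on X (\<lambda>_. 0) ?K) (shear ?K f (swap_halves n q)) \<in> J"
      unfolding genideal_append_vars[OF assms(2)] J_def using closed[OF tame p]
      by (simp add: \<phi>_def q_def)
    also have "\<dots> \<longleftrightarrow> subst (override_on X f ?K) (swap_halves n q) \<in> J"
      by (subst subst_graph_shear[where b = f]) (use vars_fg in auto)
    also have "\<dots> \<longleftrightarrow> subst (override_on X g ?K) q \<in> I"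
      using graph_ideals_match[OF I J \<alpha> f g closed[OF swap q]] by (simp add: swap_swap)
    also have "\<dots> \<longleftrightarrow> subst (override_on X (\<lambda>_. 0) ?K) p \<in> I"
      unfolding q_def by (subst subst_graph_shear[where b = "\<lambda>_. 0"]) (use vars_fg in \<open>auto simp: vars_uminus\<close>)
    also have "\<dots> \<longleftrightarrow> p \<in> V (2 * n) (ps @ map X [n + 1..<2 * n + 1])"
      unfolding genideal_append_vars[OF assms(1)] I_def using p by simp
    finally show ?thesis by simp
  qed
  have onto: "\<phi> ` carrier ?P2 = carrier ?P2"
    using tame tame_aut_subset_poly_aut by (auto simp: poly_aut_def alg_iso_def ring_iso_def bij_betw_def)
  have subset: "V (2 * n) (rs @ map X [n + 1..<2 * n + 1]) \<subseteq> carrier ?P2" if "set rs \<subseteq> carrier ?P" for rs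
    unfolding genideal_append_vars[OF that] by blast
  have "\<phi> ` V (2 * n) (ps @ map X [n + 1..<2 * n + 1]) = V (2 * n) (qs @ map X [n + 1..<2 * n + 1])"
    (is "_ ` ?A = ?B")
  proof
    show "\<phi> ` ?A \<subseteq> ?B" using mem_iff subset[OF assms(1)] by blast
    show "?B \<subseteq> \<phi> ` ?A"
    proof
      fix q assume "q \<in> ?B"
      moreover from this obtain p where "p \<in> carrier ?P2" "q = \<phi> p"
        using onto subset[OF assms(2)] by blast
      ultimately show "q \<in> \<phi> ` ?A" using mem_iff by blast
    qed
  qed
  then show ?thesis using tame unfolding tamely_equivalent_def by blast
qed

end
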